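(* Let $f\in\mathcal{G}_{sh}$ with $f(z)=z+\sum_{n=2}^{\infty}a_nz^n$. Then $$|a_2|\le1,\qquad|a_3|\le\frac12,\qquad|a_4|\le\frac13,\qquad|a_5|\le\frac14.$$ These inequalities are sharp: for each $n\in\{2,3,4,5\}$, equality in the bound for $|a_n|$ is attained by the function $$f(z)=z\exp\left(\int_0^z\frac{\sinh(t^{n-1})}{t}\,dt\right).$$
   Context: $\mathbb{D}=\{z\in\mathbb{C}:|z|<1\}$. $\mathcal{A}$ is the class of analytic functions on $\mathbb{D}$ of the form $f(z)=z+\sum_{n=2}^\infty a_nz^n$. Subordination: $f_1\prec f_2$ means there is a Schwarz function $\omega$ (analytic on $\mathbb{D}$, $|\omega(z)|\le|z|$) with $f_1(z)=f_2(\omega(z))$ for $z\in\mathbb{D}$. The class $\mathcal{G}_{sh}$ is $$\mathcal{G}_{sh}=\left\{f\in\mathcal{A}:\frac{zf'(z)}{f(z)}-1\prec\sinh(z)\right\}.$$ *)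

theory Defs
  imports "HOL-Complex_Analysis.Complex_Analysis"
begin

abbreviation unit_disc :: "complex set"
  where "unit_disc \<equiv> ball 0 1"

text \<open>\<open>f(z) = z + \<Sum>\<^sub>n\<^sub>\<ge>\<^sub>2 a\<^sub>n z\<^sup>n\<close> on the disc; the values \<open>a 0\<close> and \<open>a 1\<close> play no role.\<close>

definition normalized_expansion :: "(complex \<Rightarrow> complex) \<Rightarrow> (nat \<Rightarrow> complex) \<Rightarrow> bool"
  where "normalized_expansion f a \<longleftrightarrow>
    (\<forall>z\<in>unit_disc. (\<lambda>n. a (n + 2) * z ^ (n + 2)) sums (f z - z))"

definition class_A :: "(complex \<Rightarrow> complex) set"
  where "class_A = {f. f holomorphic_on unit_disc \<and> (\<exists>a. normalized_expansion f a)}"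

definition schwarz_function :: "(complex \<Rightarrow> complex) \<Rightarrow> bool"
  where "schwarz_function \<omega> \<longleftrightarrow>
    \<omega> holomorphic_on unit_disc \<and> (\<forall>z\<in>unit_disc. norm (\<omega> z) \<le> norm z)"

definition subordinate :: "(complex \<Rightarrow> complex) \<Rightarrow> (complex \<Rightarrow> complex) \<Rightarrow> bool"
    (infix "\<prec>\<^sub>s" 50)
  where "f1 \<prec>\<^sub>s f2 \<longleftrightarrow>
    (\<exists>\<omega>. schwarz_function \<omega> \<and> (\<forall>z\<in>unit_disc. f1 z = f2 (\<omega> z)))"

text \<open>
  The quotient \<open>z f'(z) / f(z)\<close>. For \<open>f\<close> in the class above its singularity at \<open>0\<close> is removable
  with value \<open>1\<close>, whereas division in HOL would give \<open>0\<close>. At any other zero of \<open>f\<close> in the disc the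
  quotient has a pole, so no function with such a zero satisfies the subordination below, whatever
  value HOL assigns at the pole.
\<close>

definition zf'_over_f :: "(complex \<Rightarrow> complex) \<Rightarrow> complex \<Rightarrow> complex"
  where "zf'_over_f f z = (if z = 0 then 1 else z * deriv f z / f z)"

definition class_G_sh :: "(complex \<Rightarrow> complex) set"
  where "class_G_sh = {f \<in> class_A. (\<lambda>z. zf'_over_f f z - 1) \<prec>\<^sub>s sinh}"

text \<open>
  The integral is taken along the segment from \<open>0\<close> to \<open>z\<close>. The integrand extends to an entire
  function; its HOL value at the single point \<open>t = 0\<close> does not affect the integral.
\<close>

definition extremal_function :: "nat \<Rightarrow> complex \<Rightarrow> complex"
  where "extremal_function n z =
    z * exp (contour_integral (linepath 0 z) (\<lambda>t. sinh (t ^ (n - 1)) / t))"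

end

theory Submission
  imports Defs
begin

text \<open>
  Write \<open>c\<^sub>k\<close> for the coefficients of the Schwarz function \<open>\<omega>\<close>. Comparing coefficients in
  \<open>z f' = f (1 + sinh \<omega>)\<close> expresses \<open>(n - 1) a\<^sub>n\<close> as a polynomial in \<open>c\<^sub>1, \<dots>, c\<^sub>n\<^sub>-\<^sub>1\<close>, which has to be
  bounded by \<open>1\<close>. Multiplication by \<open>\<omega>\<close> is a contraction on truncated power series: if \<open>q\<close> is a
  polynomial of degree at most \<open>n\<close>, the first coefficients of \<open>q \<omega>\<close> have \<open>\<ell>\<^sup>2\<close> norm at most that of
  \<open>q\<close>. Letting the coefficients of \<open>q\<close> be suitable polynomials in the \<open>c\<^sub>k\<close> makes the desired functional
  one of the coefficients of \<open>q \<omega>\<close>, and the contraction inequality then reduces the bound to the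
  positivity of a Hermitian form. For the extremal functions \<open>\<omega>\<close> is \<open>z\<^sup>n\<^sup>-\<^sup>1\<close>.
\<close>

section \<open>Contraction of truncated power series under a Schwarz multiplier\<close>

text \<open>Cauchy's formula for the \<open>k\<close>-th derivative on the circle of radius
  \<open>r\<close>: there \<open>cnj e * e = r^2\<close>, so dividing by \<open>e ^ k\<close>
  amounts to multiplying by \<open>cnj e ^ k / r ^ (2 * k)\<close>.\<close>

lemma circle_mean_eq_coeff:
  fixes g :: "complex \<Rightarrow> complex"
  assumes hol: "g holomorphic_on ball 0 1" and exp: "g has_fps_expansion G"
    and r: "0 < r" "r < 1"
  shows "((\<lambda>x. g (circlepath 0 r x) * cnj (circlepath 0 r x) ^ k)
           has_integral (fps_nth G k * of_real (r ^ (2 * k)))) {0..1}"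
proof -
  let ?e = "circlepath 0 r"
  have "((\<lambda>u. g u / (u - 0) ^ Suc k) has_contour_integral
          ((2 * pi * \<i>) / fact k * (deriv ^^ k) g 0)) ?e"
    using r hol
    by (intro Cauchy_has_contour_integral_higher_derivative_circlepath)
       (auto intro!: holomorphic_on_imp_continuous_on intro: holomorphic_on_subset)
  hence "((\<lambda>x. g (?e x) / ?e x ^ Suc k * vector_derivative ?e (at x within {0..1}))
          has_integral ((2 * pi * \<i>) * fps_nth G k)) {0..1}"
    by (simp add: has_contour_integral_def fps_nth_fps_expansion[OF exp])
  hence "((\<lambda>x. of_real (r ^ (2 * k)) / (2 * pi * \<i>) *
            (g (?e x) / ?e x ^ Suc k * vector_derivative ?e (at x within {0..1})))
          has_integral of_real (r ^ (2 * k)) / (2 * pi * \<i>) * ((2 * pi * \<i>) * fps_nth G k)) {0..1}"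
    by (rule has_integral_mult_right)
  thus ?thesis
  proof (subst has_integral_cong)
    fix x :: real assume x: "x \<in> {0..1}"
    define E where "E = exp (2 * of_real pi * \<i> * of_real x)"
    have e: "?e x = of_real r * E"
      by (simp add: circlepath E_def)
    have nE: "norm E = 1"
      by (simp add: E_def norm_exp_eq_Re)
    hence E0: "E \<noteq> 0" and EE: "cnj E * E = 1"
      using complex_norm_square[of E] by (auto simp: mult.commute)
    have dv: "vector_derivative ?e (at x within {0..1}) = 2 * pi * \<i> * ?e x"
      using x by (simp add: vector_derivative_circlepath01) (simp add: circlepath)
    have ek: "?e x \<noteq> 0" using E0 r by (simp add: e)
    have "cnj (?e x) * ?e x = of_real (r ^ 2)"
      using EE by (simp add: e power2_eq_square algebra_simps)
    hence "cnj (?e x) ^ k * ?e x ^ k = of_real (r ^ (2 * k))"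
      by (simp flip: power_mult_distrib add: power_mult)
    thus "g (?e x) * cnj (?e x) ^ k = of_real (r ^ (2 * k)) / (2 * pi * \<i>) *
            (g (?e x) / ?e x ^ Suc k * vector_derivative ?e (at x within {0..1}))"
      unfolding dv using ek by (simp add: field_simps)
  qed (simp add: mult_ac)
qed

text \<open>Bessel's inequality on circles of radius \<open>r < 1\<close>, where the monomials are
  orthogonal, bounds the truncated sum for \<open>g\<close> by the mean square of the dominating
  polynomial; then \<open>r\<close> tends to 1.\<close>

lemma bessel_circle:
  fixes g :: "complex \<Rightarrow> complex"
  assumes hol: "g holomorphic_on ball 0 1" and exp: "g has_fps_expansion G"
    and bound: "\<And>z. norm z < 1 \<Longrightarrow> norm (g z) \<le> norm (\<Sum>j\<le>n. q j * z ^ j)"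
  shows "(\<Sum>k\<le>n. (norm (fps_nth G k))\<^sup>2) \<le> (\<Sum>k\<le>n. (norm (q k))\<^sup>2)"
proof -
  define P where "P = (\<lambda>c z. \<Sum>j\<le>n. c j * z ^ j :: complex)"
  \<comment> \<open>By Parseval, \<open>m r c\<close> is the mean of \<open>|P c|^2\<close> over the
    circle of radius \<open>r\<close>.\<close>
  define m where "m = (\<lambda>r c. \<Sum>k\<le>n. (norm (c k :: complex))\<^sup>2 * r ^ (2 * k) :: real)"
  have P_hol: "P c holomorphic_on ball 0 1" for c
    unfolding P_def by (intro holomorphic_intros)
  have P_exp: "P c has_fps_expansion (\<Sum>j\<le>n. fps_const (c j) * fps_X ^ j)" for c
    unfolding P_def by (intro fps_expansion_intros)
  have P_nth: "fps_nth (\<Sum>j\<le>n. fps_const (c j) * fps_X ^ j) k = c k" if "k \<le> n" for c :: "nat \<Rightarrow> complex" and k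
    using that by (simp add: fps_sum_nth if_distrib[of "(*) _"] sum.delta' cong: if_cong)
  have *: "m r (fps_nth G) \<le> m r q" if r: "0 < r" "r < 1" for r
  proof -
    let ?e = "circlepath 0 r"
    have e1: "norm (?e x) < 1" for x
      using r by (simp add: circlepath norm_mult norm_exp_eq_Re)
    have inner: "((\<lambda>x. Re (h (?e x) * cnj (P c (?e x)))) has_integral
        (\<Sum>k\<le>n. Re (fps_nth H k * cnj (c k)) * r ^ (2 * k))) {0..1}"
      if h: "h holomorphic_on ball 0 1" "h has_fps_expansion H" for h H c
    proof -
      have "((\<lambda>x. Re (\<Sum>k\<le>n. cnj (c k) * (h (?e x) * cnj (?e x) ^ k))) has_integral
              Re (\<Sum>k\<le>n. cnj (c k) * (fps_nth H k * of_real (r ^ (2 * k))))) {0..1}"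
        by (intro has_integral_Re has_integral_sum has_integral_mult_right
              circle_mean_eq_coeff h r) auto
      also have "(\<lambda>x. Re (\<Sum>k\<le>n. cnj (c k) * (h (?e x) * cnj (?e x) ^ k))) =
          (\<lambda>x. Re (h (?e x) * cnj (P c (?e x))))"
        by (simp add: P_def sum_distrib_left mult_ac)
      also have "Re (\<Sum>k\<le>n. cnj (c k) * (fps_nth H k * of_real (r ^ (2 * k)))) =
          (\<Sum>k\<le>n. Re (fps_nth H k * cnj (c k)) * r ^ (2 * k))"
        unfolding Re_sum
      proof (rule sum.cong)
        fix k
        have "cnj (c k) * (fps_nth H k * of_real (r ^ (2 * k))) =
                of_real (r ^ (2 * k)) * (fps_nth H k * cnj (c k))"
          by (simp only: mult_ac)
        thus "Re (cnj (c k) * (fps_nth H k * of_real (r ^ (2 * k)))) =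
                Re (fps_nth H k * cnj (c k)) * r ^ (2 * k)"
          by (simp only: times_complex.simps Re_complex_of_real Im_complex_of_real)
             (simp add: mult_ac)
      qed auto
      finally show ?thesis .
    qed
    have normP: "((\<lambda>x. (norm (P c (?e x)))\<^sup>2) has_integral m r c) {0..1}" for c
    proof -
      have "((\<lambda>x. Re (P c (?e x) * cnj (P c (?e x)))) has_integral m r c) {0..1}"
        using inner[OF P_hol P_exp, of c c]
        by (simp add: P_nth m_def flip: complex_norm_square)
      thus ?thesis by (simp flip: complex_norm_square)
    qed
    define s where "s = fps_nth G"
    have gs: "((\<lambda>x. Re (g (?e x) * cnj (P s (?e x)))) has_integral m r s) {0..1}"
      using inner[OF hol exp, of s]
      by (simp add: m_def s_def flip: complex_norm_square)
    \<comment> \<open>For \<open>a = g\<close> and \<open>b = P s\<close>, its Taylor polynomial,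
      \<open>2 Re (a cnj b) - |b|^2 \<le> |a|^2\<close> holds pointwise, and the left side has mean
      \<open>m r s\<close>. This avoids integrating \<open>|g|^2\<close>.\<close>
    have "m r s + m r s - m r s \<le> m r q"
    proof (rule has_integral_le)
      show "((\<lambda>x. Re (g (?e x) * cnj (P s (?e x))) + Re (g (?e x) * cnj (P s (?e x)))
                - (norm (P s (?e x)))\<^sup>2) has_integral (m r s + m r s - m r s)) {0..1}"
        by (intro has_integral_add has_integral_diff gs normP)
      show "((\<lambda>x. (norm (P q (?e x)))\<^sup>2) has_integral m r q) {0..1}"
        by (rule normP)
    next
      fix x :: real
      define a b where "a = g (?e x)" and "b = P s (?e x)"
      have "0 \<le> (norm (a - b))\<^sup>2" by simp
      also have "\<dots> = (norm a)\<^sup>2 - 2 * Re (a * cnj b) + (norm b)\<^sup>2"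
        unfolding cmod_power2 by (simp add: power2_eq_square algebra_simps)
      finally have "Re (a * cnj b) + Re (a * cnj b) - (norm b)\<^sup>2 \<le> (norm a)\<^sup>2" by simp
      also have "\<dots> \<le> (norm (P q (?e x)))\<^sup>2"
        using bound[OF e1[of x]] by (auto simp: a_def P_def intro: power_mono)
      finally show "Re (g (?e x) * cnj (P s (?e x))) + Re (g (?e x) * cnj (P s (?e x)))
                - (norm (P s (?e x)))\<^sup>2 \<le> (norm (P q (?e x)))\<^sup>2"
        by (simp add: a_def b_def)
    qed
    thus ?thesis by (simp add: s_def)
  qed
  have lim: "((\<lambda>r. m r c) \<longlongrightarrow> m 1 c) (at_left 1)" for c
    unfolding m_def by (intro tendsto_intros)
  have "m 1 (fps_nth G) \<le> m 1 q"
  proof (rule tendsto_le[OF _ lim lim])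
    show "\<forall>\<^sub>F r in at_left 1. m r (fps_nth G) \<le> m r q"
      using eventually_at_left_real[OF zero_less_one] by (rule eventually_mono) (simp add: *)
  qed auto
  thus ?thesis by (simp add: m_def)
qed

text \<open>As \<open>|\<omega>| \<le> 1\<close>, the polynomial \<open>q\<close> dominates
  \<open>q \<omega>\<close> pointwise, which is what \<open>bessel_circle\<close> asks for.\<close>

lemma schwarz_contraction:
  fixes \<omega> :: "complex \<Rightarrow> complex"
  assumes \<omega>: "schwarz_function \<omega>" and W: "\<omega> has_fps_expansion W"
  shows "(\<Sum>k\<le>n. (norm (\<Sum>j\<le>k. q j * fps_nth W (k - j)))\<^sup>2) \<le> (\<Sum>k\<le>n. (norm (q k))\<^sup>2)"
proof -
  let ?Q = "\<Sum>j\<le>n. fps_const (q j) * fps_X ^ j"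
  have Q: "fps_nth ?Q k = (if k \<le> n then q k else 0)" for k
    by (simp add: fps_sum_nth if_distrib[of "(*) _"] sum.delta' cong: if_cong)
  have "(\<Sum>k\<le>n. (norm (fps_nth (?Q * W) k))\<^sup>2) \<le> (\<Sum>k\<le>n. (norm (q k))\<^sup>2)"
  proof (rule bessel_circle)
    show "(\<lambda>z. (\<Sum>j\<le>n. q j * z ^ j) * \<omega> z) holomorphic_on ball 0 1"
      using \<omega> by (auto simp: schwarz_function_def intro!: holomorphic_intros)
    show "(\<lambda>z. (\<Sum>j\<le>n. q j * z ^ j) * \<omega> z) has_fps_expansion ?Q * W"
      by (intro fps_expansion_intros W)
    fix z :: complex assume "norm z < 1"
    hence "norm (\<omega> z) \<le> 1" using \<omega> by (force simp: schwarz_function_def)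
    thus "norm ((\<Sum>j\<le>n. q j * z ^ j) * \<omega> z) \<le> norm (\<Sum>j\<le>n. q j * z ^ j)"
      by (simp add: norm_mult mult_left_le)
  qed
  also have "(\<Sum>k\<le>n. (norm (fps_nth (?Q * W) k))\<^sup>2) =
      (\<Sum>k\<le>n. (norm (\<Sum>j\<le>k. q j * fps_nth W (k - j)))\<^sup>2)"
    by (intro sum.cong refl) (auto simp: fps_mult_nth Q atLeast0AtMost)
  finally show ?thesis .
qed

section \<open>Bounds for coefficient functionals of Schwarz functions\<close>

lemma schwarz_coeff_0:
  assumes "schwarz_function \<omega>" "\<omega> has_fps_expansion W"
  shows "fps_nth W 0 = 0"
proof -
  have "norm (\<omega> 0) \<le> norm (0::complex)"
    using assms(1) unfolding schwarz_function_def by (metis centre_in_ball zero_less_one)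
  thus ?thesis using has_fps_expansion_imp_0_eq_fps_nth_0[OF assms(2)] by simp
qed

lemma schwarz_norm_coeff_1:
  assumes "schwarz_function \<omega>" "\<omega> has_fps_expansion W"
  shows "norm (fps_nth W 1) \<le> 1"
  using schwarz_contraction[OF assms, where n = 1 and q = "\<lambda>k. if k = 0 then 1 else 0"]
  by (simp add: schwarz_coeff_0[OF assms] abs_square_le_1)

text \<open>The multiplier \<open>1 + c 1 * z\<close> produces the functional at index 2, and
  \<open>|c 1|^2\<close> cancels from the two sides. The last entry of \<open>q\<close> meets only
  \<open>c 0 = 0\<close>, hence is taken to be 0.\<close>

lemma schwarz_norm_functional_2:
  fixes W :: "complex fps"
  assumes "schwarz_function \<omega>" "\<omega> has_fps_expansion W"
  defines "c \<equiv> fps_nth W"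
  shows "norm (c 2 + (c 1)\<^sup>2) \<le> 1"
proof -
  have "(norm (c 2 + (c 1)\<^sup>2))\<^sup>2 \<le> 1"
    using schwarz_contraction[OF assms(1,2), where n = 2 and q = "\<lambda>k. [1, c 1, 0] ! k"]
    by (simp add: schwarz_coeff_0[OF assms(1,2)] c_def eval_nat_numeral algebra_simps)
  thus ?thesis by (simp add: abs_square_le_1)
qed

text \<open>The weight \<open>3/4\<close> splits \<open>3/2 * c 1 * c 2\<close> evenly between
  \<open>q 1\<close> and \<open>q 2\<close>; the \<open>2/3\<close> in \<open>q 2\<close> is forced
  by the term in \<open>c 1 ^ 3\<close>.\<close>

lemma schwarz_norm_functional_3:
  fixes W :: "complex fps"
  assumes "schwarz_function \<omega>" "\<omega> has_fps_expansion W"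
  defines "c \<equiv> fps_nth W"
  shows "norm (c 3 + 3/2 * c 1 * c 2 + 2/3 * c 1 ^ 3) \<le> 1"
proof -
  define w where "w = (c 1)\<^sup>2"
  have "(norm (c 1))\<^sup>2 + (norm (c 2 + 3/4 * w))\<^sup>2 +
      (norm (c 3 + 3/2 * c 1 * c 2 + 2/3 * c 1 ^ 3))\<^sup>2
      \<le> 1 + (norm (3/4 * c 1))\<^sup>2 + (norm (3/4 * c 2 + 2/3 * w))\<^sup>2"
    using schwarz_contraction[OF assms(1,2), where n = 3 and
        q = "\<lambda>k. [1, 3/4 * c 1, 3/4 * c 2 + 2/3 * w, 0] ! k"]
    by (simp add: schwarz_coeff_0[OF assms(1,2)] c_def w_def eval_nat_numeral algebra_simps)
  \<comment> \<open>The surplus \<open>7/16 |c 1|^2\<close> pays for \<open>7/16 |w|^2\<close>,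
    which makes the Hermitian form in \<open>c 2\<close> and \<open>w\<close> positive; it is then
    written as a sum of squares.\<close>
  moreover have "(norm w)\<^sup>2 \<le> (norm (c 1))\<^sup>2"
    using schwarz_norm_coeff_1[OF assms(1,2)]
    by (auto simp: w_def c_def norm_mult power2_eq_square intro!: mult_mono mult_left_le mult_le_one)
  moreover have "(norm (3/4 * c 1))\<^sup>2 = 9/16 * (norm (c 1))\<^sup>2"
    by (simp add: norm_mult power_mult_distrib power2_eq_square)
  moreover have "(norm (c 2 + 3/4 * w))\<^sup>2 - (norm (3/4 * c 2 + 2/3 * w))\<^sup>2 + 7/16 * (norm w)\<^sup>2
      = 1/4 * (norm (c 2 + w))\<^sup>2 + 3/16 * (norm (c 2))\<^sup>2 + 11/36 * (norm w)\<^sup>2"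
    unfolding cmod_power2 by (simp add: power2_eq_square field_simps)
  moreover have "0 \<le> (norm (c 2 + w))\<^sup>2" "0 \<le> (norm (c 2))\<^sup>2" "0 \<le> (norm w)\<^sup>2"
    by simp_all
  ultimately have "(norm (c 3 + 3/2 * c 1 * c 2 + 2/3 * c 1 ^ 3))\<^sup>2 \<le> 1"
    by argo
  thus ?thesis by (simp add: abs_square_le_1)
qed

text \<open>
  The multiplier \<open>q\<close> is chosen so that the last entry of \<open>q \<cdot> \<omega>\<close> is the functional to be bounded.
  The weight \<open>2/3\<close> splits the term in \<open>c\<^sub>1 c\<^sub>3\<close> evenly between \<open>q\<^sub>1\<close> and \<open>q\<^sub>3\<close>, and the coefficient
  \<open>2/3\<close> of \<open>c\<^sub>1\<^sup>2\<close> in \<open>q\<^sub>2\<close> is the free parameter: with this value, completing the square in \<open>c\<^sub>3\<close>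
  leaves the multiple \<open>-1/180\<close> of \<open>|c\<^sub>1|\<^sup>2 |c\<^sub>2 - c\<^sub>1\<^sup>2|\<^sup>2\<close> as the only negative remainder.
\<close>

lemma schwarz_norm_functional_4:
  fixes W :: "complex fps"
  assumes "schwarz_function \<omega>" "\<omega> has_fps_expansion W"
  defines "c \<equiv> fps_nth W"
  shows "norm (c 4 + 4/3 * c 1 * c 3 + 1/2 * (c 2)\<^sup>2 + 3/2 * (c 1)\<^sup>2 * c 2 + 7/18 * c 1 ^ 4) \<le> 1"
    (is "norm ?E \<le> 1")
proof -
  define w where "w = (c 1)\<^sup>2"
  \<comment> \<open>The monomials of weight 3, when \<open>c k\<close> has weight
    \<open>k\<close>.\<close>
  define X Y Z where "X = c 3" and "Y = c 1 * c 2" and "Z = c 1 * w"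
  define x where "x = (norm (c 1))\<^sup>2"
  have "x + (norm (c 2 + 2/3 * w))\<^sup>2 + (norm (X + 7/6 * Y + 2/3 * Z))\<^sup>2 + (norm ?E)\<^sup>2
      \<le> 1 + (norm (2/3 * c 1))\<^sup>2 + (norm (1/2 * c 2 + 2/3 * w))\<^sup>2
          + (norm (2/3 * X + 5/6 * Y + 7/18 * Z))\<^sup>2"
    using schwarz_contraction[OF assms(1,2), where n = 4 and
        q = "\<lambda>k. [1, 2/3 * c 1, 1/2 * c 2 + 2/3 * w, 2/3 * X + 5/6 * Y + 7/18 * Z, 0] ! k"]
    by (simp add: schwarz_coeff_0[OF assms(1,2)] c_def w_def x_def X_def Y_def Z_def
          eval_nat_numeral algebra_simps)
  moreover have x1: "x \<le> 1" "0 \<le> x"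
    using schwarz_norm_coeff_1[OF assms(1,2)] by (simp_all add: x_def c_def abs_square_le_1)
  moreover have "(norm w)\<^sup>2 \<le> x"
  proof -
    have "(norm w)\<^sup>2 = x * x"
      by (simp add: w_def x_def norm_mult power2_eq_square)
    thus ?thesis using x1 by (simp add: mult_left_le)
  qed
  moreover have "(norm (2/3 * c 1))\<^sup>2 = 4/9 * x"
    by (simp add: norm_mult x_def power_mult_distrib power2_eq_square)
  moreover have "(norm (c 2 + 2/3 * w))\<^sup>2 - (norm (1/2 * c 2 + 2/3 * w))\<^sup>2
      = 1/3 * (norm (c 2 + w))\<^sup>2 + 5/12 * (norm (c 2))\<^sup>2 - 1/3 * (norm w)\<^sup>2"
    unfolding cmod_power2 by (simp add: power2_eq_square field_simps)
  moreover have "(norm (X + 7/6 * Y + 2/3 * Z))\<^sup>2 - (norm (2/3 * X + 5/6 * Y + 7/18 * Z))\<^sup>2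
      = 5/9 * (norm (X + 11/10 * Y + 11/15 * Z))\<^sup>2 - 1/180 * (norm (Y - Z))\<^sup>2"
    unfolding cmod_power2 by (simp add: power2_eq_square field_simps)
  \<comment> \<open>The negative remainder is at most \<open>1/180 |c 2 - w|^2\<close>, hence by the
    parallelogram law at most \<open>1/90 (|c 2|^2 + |w|^2)\<close>. This is absorbed by
    \<open>5/12 |c 2|^2\<close> and by \<open>5/9 x - 1/3 |w|^2 \<ge> 2/9 |w|^2\<close>.\<close>
  moreover have "(norm (Y - Z))\<^sup>2 = x * (norm (c 2 - w))\<^sup>2"
    unfolding Y_def Z_def x_def by (simp add: norm_mult power_mult_distrib flip: right_diff_distrib)
  moreover have "x * (norm (c 2 - w))\<^sup>2 \<le> (norm (c 2 - w))\<^sup>2"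
    using x1 by (simp add: mult_left_le_one_le)
  moreover have "(norm (c 2 - w))\<^sup>2 = 2 * (norm (c 2))\<^sup>2 + 2 * (norm w)\<^sup>2 - (norm (c 2 + w))\<^sup>2"
    unfolding cmod_power2 by (simp add: power2_eq_square field_simps)
  moreover have "0 \<le> (norm (c 2 + w))\<^sup>2" "0 \<le> (norm (c 2))\<^sup>2" "0 \<le> (norm w)\<^sup>2"
      "0 \<le> (norm (X + 11/10 * Y + 11/15 * Z))\<^sup>2"
    by simp_all
  ultimately have "(norm ?E)\<^sup>2 \<le> 1"
    by argo
  thus ?thesis by (simp add: abs_square_le_1)
qed

section \<open>Coefficients of \<open>f\<close> in terms of those of the Schwarz function\<close>

text \<open>The entries 0 and 1 of \<open>A\<close> at the first two indices restore the summand
  \<open>z\<close>, which is subtracted in \<open>normalized_expansion\<close>.\<close>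

lemma normalized_expansion_imp_has_fps_expansion:
  assumes "normalized_expansion f a"
  defines "A \<equiv> Abs_fps (\<lambda>n. if n = 0 then 0 else if n = 1 then 1 else a n)"
  shows "f has_fps_expansion A"
proof (rule has_fps_expansionI)
  have "(\<lambda>n. fps_nth A n * z ^ n) sums f z" if "z \<in> unit_disc" for z
  proof -
    have "(\<lambda>n. fps_nth A (n + 2) * z ^ (n + 2)) sums (f z - (\<Sum>n<2. fps_nth A n * z ^ n))"
      using assms that by (simp add: normalized_expansion_def A_def numeral_2_eq_2)
    thus ?thesis by (subst (asm) sums_iff_shift') simp
  qed
  moreover have "\<forall>\<^sub>F z in nhds 0. z \<in> unit_disc"
    by (intro eventually_nhds_in_open) auto
  ultimately show "\<forall>\<^sub>F z in nhds 0. (\<lambda>n. fps_nth A n * z ^ n) sums f z"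
    by (rule eventually_mono[rotated])
qed

text \<open>Serves both halves of the result: a general \<open>\<omega>\<close> for the bounds, a
  power of \<open>z\<close> for sharpness.\<close>

lemma class_A_coeffs:
  fixes a :: "nat \<Rightarrow> complex" and W :: "complex fps"
  assumes f: "f holomorphic_on unit_disc" "normalized_expansion f a"
    and \<omega>: "schwarz_function \<omega>" "\<omega> has_fps_expansion W"
    and eq: "\<And>z. z \<in> unit_disc \<Longrightarrow> zf'_over_f f z - 1 = sinh (\<omega> z)"
  defines "c \<equiv> fps_nth W"
  shows "a 2 = c 1"
    and "2 * a 3 = c 2 + (c 1)\<^sup>2"
    and "3 * a 4 = c 3 + 3/2 * c 1 * c 2 + 2/3 * c 1 ^ 3"
    and "4 * a 5 = c 4 + 4/3 * c 1 * c 3 + 1/2 * (c 2)\<^sup>2 + 3/2 * (c 1)\<^sup>2 * c 2 + 7/18 * c 1 ^ 4"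
proof -
  define A where "A = Abs_fps (\<lambda>n. if n = 0 then 0 else if n = 1 then 1 else a n)"
  define S :: "complex fps" where "S = fps_const (1/2) * (fps_exp 1 - fps_exp (-1))"
  have fA: "f has_fps_expansion A"
    unfolding A_def by (rule normalized_expansion_imp_has_fps_expansion[OF f(2)])
  have f0: "f 0 = 0"
    using has_fps_expansion_imp_0_eq_fps_nth_0[OF fA] by (simp add: A_def)
  have c0: "fps_nth W 0 = 0" by (rule schwarz_coeff_0[OF \<omega>])
  have \<omega>0: "\<omega> 0 = 0"
    using has_fps_expansion_imp_0_eq_fps_nth_0[OF \<omega>(2)] c0 by simp
  have "(\<lambda>z::complex. 1/2 * (exp z - exp (-z))) has_fps_expansion S"
    unfolding S_def by (intro fps_expansion_intros)
  hence "sinh has_fps_expansion S"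
    by (simp add: sinh_def [abs_def] scaleR_conv_of_real)
  from has_fps_expansion_compose[OF this \<omega>(2) c0]
  have comp: "(\<lambda>z. sinh (\<omega> z)) has_fps_expansion (S oo W)" by (simp add: o_def)
  \<comment> \<open>At a zero \<open>z \<noteq> 0\<close> of \<open>f\<close> the HOL quotient is 0,
    which would force \<open>sinh (\<omega> z) = -1\<close>. Continuity excludes this near 0, and an
    identity near 0 suffices to compare power series.\<close>
  have "continuous (at 0) (\<lambda>z. sinh (\<omega> z))"
    using comp has_fps_expansion_imp_continuous[of _ _ UNIV] by blast
  hence "((\<lambda>z. sinh (\<omega> z)) \<longlongrightarrow> 0) (nhds 0)"
    using \<omega>0 by (simp add: continuous_at tendsto_nhds_iff)
  hence "\<forall>\<^sub>F z in nhds 0. sinh (\<omega> z) \<noteq> -1"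
    by (rule tendsto_imp_eventually_ne) auto
  moreover have "\<forall>\<^sub>F z in nhds 0. z \<in> unit_disc"
    by (intro eventually_nhds_in_open) auto
  ultimately have ev: "\<forall>\<^sub>F z in nhds 0. z * deriv f z = f z * (1 + sinh (\<omega> z))"
  proof eventually_elim
    case (elim z)
    from eq[OF elim(2)] elim(1) f0 show ?case
      by (cases "z = 0"; cases "f z = 0") (auto simp: zf'_over_f_def field_simps)
  qed
  have lhs: "(\<lambda>z. z * deriv f z) has_fps_expansion fps_X * fps_deriv A"
    by (intro fps_expansion_intros fA)
  have rhs: "(\<lambda>z. f z * (1 + sinh (\<omega> z))) has_fps_expansion (A * (1 + (S oo W)))"
    by (intro fps_expansion_intros fA comp)
  have "(\<lambda>z. z * deriv f z) has_fps_expansion (A * (1 + (S oo W)))"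
    using rhs has_fps_expansion_cong[OF ev refl] by simp
  with lhs have "fps_X * fps_deriv A = A * (1 + (S oo W))"
    by (rule fps_expansion_unique_complex)
  hence nth: "fps_nth (fps_X * fps_deriv A) n = fps_nth (A * (1 + (S oo W))) n" for n by simp
  have A: "fps_nth A 0 = 0" "fps_nth A (Suc 0) = 1" "fps_nth A 2 = a 2" "fps_nth A 3 = a 3"
      "fps_nth A 4 = a 4" "fps_nth A 5 = a 5"
    by (simp_all add: A_def)
  have S: "fps_nth S 0 = 0" "fps_nth S (Suc 0) = 1" "fps_nth S 2 = 0" "fps_nth S 3 = 1/6" "fps_nth S 4 = 0"
    by (simp_all add: S_def fact_numeral)
  have W2: "fps_nth (W\<^sup>2) 0 = 0" "fps_nth (W\<^sup>2) 1 = 0" "fps_nth (W\<^sup>2) 2 = (c 1)\<^sup>2"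
      "fps_nth (W\<^sup>2) 3 = 2 * c 1 * c 2"
    using c0 by (simp_all add: c_def power2_eq_square fps_mult_nth eval_nat_numeral algebra_simps)
  have W3: "fps_nth (W ^ 3) 0 = 0" "fps_nth (W ^ 3) 1 = 0" "fps_nth (W ^ 3) 2 = 0"
      "fps_nth (W ^ 3) 3 = c 1 ^ 3" "fps_nth (W ^ 3) 4 = 3 * (c 1)\<^sup>2 * c 2"
    unfolding power3_eq_cube power2_eq_square using c0
    by (simp_all add: c_def fps_mult_nth eval_nat_numeral algebra_simps)
  \<comment> \<open>As \<open>W\<close> has no constant term, only \<open>W + W ^ 3 / 6\<close>
    contributes up to degree 4.\<close>
  have T: "fps_nth (S oo W) 0 = 0" "fps_nth (S oo W) 1 = c 1" "fps_nth (S oo W) 2 = c 2"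
      "fps_nth (S oo W) 3 = c 3 + c 1 ^ 3 / 6"
      "fps_nth (S oo W) 4 = c 4 + (c 1)\<^sup>2 * c 2 / 2"
    unfolding fps_compose_nth atLeast0AtMost
    by (simp_all add: S W2 W3 c0 atMost_nat_numeral c_def)
  \<comment> \<open>The constant term of \<open>S oo W\<close> vanishes, so the convolution stops
    below \<open>n\<close> and earlier coefficients determine
    \<open>(n - 1) * fps_nth A n\<close>.\<close>
  have rec: "of_nat n * fps_nth A n = fps_nth A n + (\<Sum>i<n. fps_nth A i * fps_nth (S oo W) (n - i))"
    if "n \<ge> 1" for n
  proof -
    have "of_nat n * fps_nth A n = fps_nth (fps_X * fps_deriv A) n"
      using that by (cases n) simp_all
    also have "\<dots> = fps_nth A n + fps_nth (A * (S oo W)) n"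
      by (simp only: nth distrib_left mult_1_right fps_add_nth)
    also have "fps_nth (A * (S oo W)) n = (\<Sum>i<n. fps_nth A i * fps_nth (S oo W) (n - i))"
      using T(1) by (simp add: fps_mult_nth atLeast0AtMost sum.lessThan_Suc flip: lessThan_Suc_atMost)
    finally show ?thesis .
  qed
  show a2: "a 2 = c 1"
    using rec[of 2] T by (simp add: A lessThan_nat_numeral)
  show a3: "2 * a 3 = c 2 + (c 1)\<^sup>2"
    using rec[of 3] T by (simp add: A lessThan_nat_numeral a2 power2_eq_square)
  have "3 * a 4 = fps_nth (S oo W) 3 + a 2 * c 2 + a 3 * c 1"
    using rec[of 4] T by (simp add: A lessThan_nat_numeral)
  moreover have a3': "a 3 = (c 2 + (c 1)\<^sup>2) / 2" using a3 by (simp add: eq_divide_eq mult.commute)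
  ultimately show a4: "3 * a 4 = c 3 + 3/2 * c 1 * c 2 + 2/3 * c 1 ^ 3"
    unfolding a2 a3' T
    by (simp add: algebra_simps add_divide_distrib power3_eq_cube power2_eq_square)
  have "4 * a 5 = fps_nth (S oo W) 4 + a 2 * fps_nth (S oo W) 3 + a 3 * c 2 + a 4 * c 1"
    using rec[of 5] T by (simp add: A lessThan_nat_numeral)
  moreover have a4': "a 4 = (c 3 + 3/2 * c 1 * c 2 + 2/3 * c 1 ^ 3) / 3"
    unfolding a4 [symmetric] by (rule nonzero_mult_div_cancel_left [symmetric]) (rule zero_neq_numeral [symmetric])
  ultimately show "4 * a 5 = c 4 + 4/3 * c 1 * c 3 + 1/2 * (c 2)\<^sup>2 + 3/2 * (c 1)\<^sup>2 * c 2 + 7/18 * c 1 ^ 4"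
    unfolding a2 a3' a4' T
    by (simp add: algebra_simps add_divide_distrib power4_eq_xxxx power3_eq_cube power2_eq_square)
qed

section \<open>The extremal functions\<close>

text \<open>For \<open>m \<ge> 1\<close> the numerator vanishes at 0, so the singularity is
  removable and the entire extension has a primitive.\<close>

lemma sinh_power_div_primitive:
  assumes "m \<ge> 1"
  obtains G :: "complex \<Rightarrow> complex" where "G holomorphic_on UNIV" "G 0 = 0"
    "\<And>z. z \<noteq> 0 \<Longrightarrow> (G has_field_derivative sinh (z ^ m) / z) (at z)"
    "\<And>z. contour_integral (linepath 0 z) (\<lambda>t. sinh (t ^ m) / t) = G z"
proof -
  define g where "g = (\<lambda>z::complex. if z = 0 then deriv (\<lambda>z. sinh (z ^ m)) 0 else sinh (z ^ m) / z)"
  have "(\<lambda>z::complex. sinh (z ^ m)) holomorphic_on UNIV"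
    by (intro analytic_imp_holomorphic analytic_intros)
  hence "g holomorphic_on UNIV"
  proof (rule pole_theorem_0)
    show "g 0 = deriv (\<lambda>z. sinh (z ^ m)) 0" by (simp add: g_def)
    show "sinh (0 ^ m) = (0::complex)" using assms by (simp add: power_0_left)
  qed (simp_all add: g_def)
  then obtain G0 where G0: "\<And>z. (G0 has_field_derivative g z) (at z)"
    using holomorphic_convex_primitive'[of UNIV g] by auto
  define G where "G = (\<lambda>z. G0 z - G0 0)"
  have G: "(G has_field_derivative g z) (at z)" for z
    unfolding G_def by (auto intro!: derivative_eq_intros G0)
  show thesis
  proof
    show "G holomorphic_on UNIV"
      using G by (auto simp: holomorphic_on_open)
    show "G 0 = 0" by (simp add: G_def)
    show "(G has_field_derivative sinh (z ^ m) / z) (at z)" if "z \<noteq> 0" for z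
      using G[of z] that by (simp add: g_def)
    fix z
    have "(g has_contour_integral G z - G 0) (linepath 0 z)"
      using contour_integral_primitive[of UNIV G g "linepath 0 z"] G by simp
    hence *: "((\<lambda>x. g (linepath 0 z x) * (z - 0)) has_integral G z) {0..1}"
      by (simp add: has_contour_integral_linepath \<open>G 0 = 0\<close>)
    \<comment> \<open>The integrands can differ only at \<open>x = 0\<close>: for
      \<open>z = 0\<close> the factor \<open>z - 0\<close> makes both vanish.\<close>
    have "((\<lambda>x. sinh (linepath 0 z x ^ m) / linepath 0 z x * (z - 0)) has_integral G z) {0..1}"
      by (rule has_integral_spike_finite[OF _ _ *, of "{0}"]) (auto simp: g_def linepath_def)
    thus "contour_integral (linepath 0 z) (\<lambda>t. sinh (t ^ m) / t) = G z"
      by (intro contour_integral_unique) (simp add: has_contour_integral_linepath)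
  qed
qed

lemma normalized_expansion_taylor:
  assumes f: "f holomorphic_on unit_disc" "f 0 = 0" "deriv f 0 = 1"
  shows "normalized_expansion f (\<lambda>n. (deriv ^^ n) f 0 / fact n)"
  unfolding normalized_expansion_def
proof
  fix z assume "z \<in> unit_disc"
  from holomorphic_power_series[OF f(1) this] f(2,3)
  show "(\<lambda>n. (deriv ^^ (n + 2)) f 0 / fact (n + 2) * z ^ (n + 2)) sums (f z - z)"
    by (subst sums_iff_shift) (simp_all add: eval_nat_numeral)
qed

text \<open>Logarithmic differentiation of \<open>z * exp (G z)\<close> gives
  \<open>z f' / f = 1 + z G'\<close>, and \<open>z G'\<close> is
  \<open>sinh (z ^ (n - 1))\<close>.\<close>

lemma extremal_function_in_class:
  assumes n: "n \<ge> 2"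
  defines "f \<equiv> extremal_function n"
  shows "f holomorphic_on unit_disc" "\<exists>a. normalized_expansion f a"
    "\<And>z. zf'_over_f f z - 1 = sinh (z ^ (n - 1))"
proof -
  have "n - 1 \<ge> 1" using n by simp
  then obtain G :: "complex \<Rightarrow> complex" where G: "G holomorphic_on UNIV" "G 0 = 0"
    "\<And>z. z \<noteq> 0 \<Longrightarrow> (G has_field_derivative sinh (z ^ (n - 1)) / z) (at z)"
    "\<And>z. contour_integral (linepath 0 z) (\<lambda>t. sinh (t ^ (n - 1)) / t) = G z"
    by (rule sinh_power_div_primitive) blast
  have f: "f = (\<lambda>z. z * exp (G z))"
    by (intro ext) (simp only: f_def extremal_function_def G(4))
  have hol: "G holomorphic_on unit_disc" using G(1) holomorphic_on_subset by blast
  show f_hol: "f holomorphic_on unit_disc"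
    unfolding f by (intro holomorphic_intros hol)
  \<comment> \<open>At 0 the factor \<open>z\<close> kills the term with \<open>G'\<close>, so its
    value there is irrelevant and \<open>f' 0 = exp (G 0) = 1\<close>.\<close>
  have "(G has_field_derivative deriv G 0) (at 0)"
    using G(1) holomorphic_derivI by blast
  hence "(f has_field_derivative 1) (at 0)"
    unfolding f using G(2) by (auto intro!: derivative_eq_intros)
  hence "deriv f 0 = 1" by (rule DERIV_imp_deriv)
  moreover have "f 0 = 0" by (simp add: f)
  ultimately show "\<exists>a. normalized_expansion f a"
    using normalized_expansion_taylor[OF f_hol] by blast
  show "zf'_over_f f z - 1 = sinh (z ^ (n - 1))" for z
  proof (cases "z = 0")
    case True
    thus ?thesis using n by (simp add: zf'_over_f_def power_0_left)
  next
    case False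
    have "(f has_field_derivative exp (G z) * (1 + sinh (z ^ (n - 1)))) (at z)"
      unfolding f using False by (auto intro!: derivative_eq_intros G(3) simp: algebra_simps)
    hence "deriv f z = exp (G z) * (1 + sinh (z ^ (n - 1)))" by (rule DERIV_imp_deriv)
    thus ?thesis using False by (simp add: zf'_over_f_def f)
  qed
qed

lemma schwarz_function_power:
  assumes "m \<ge> 1"
  shows "schwarz_function (\<lambda>z. z ^ m)"
  unfolding schwarz_function_def
proof (intro conjI ballI)
  fix z :: complex assume "z \<in> unit_disc"
  thus "norm (z ^ m) \<le> norm z"
    using power_decreasing[OF assms, of "norm z"] by (simp add: norm_power)
qed (intro holomorphic_intros)

section \<open>Coefficient bounds and their sharpness\<close>

theorem theorem6:
  shows "(\<forall>f a. f \<in> class_G_sh \<and> normalized_expansion f a \<longrightarrow>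
            norm (a 2) \<le> 1 \<and> norm (a 3) \<le> 1 / 2 \<and> norm (a 4) \<le> 1 / 3 \<and> norm (a 5) \<le> 1 / 4)
       \<and> (\<forall>n\<in>{2, 3, 4, 5}. extremal_function n \<in> class_G_sh \<and>
            (\<exists>a. normalized_expansion (extremal_function n) a \<and> norm (a n) = 1 / (real n - 1)))"
proof (intro conjI allI impI ballI, goal_cases)
  \<comment> \<open>Goals 1 to 4 are the bounds, proved last; 5 is membership and 6
    attainment.\<close>
  case (5 n)
  thus ?case
    using extremal_function_in_class[of n] schwarz_function_power[of "n - 1"]
    by (auto simp: class_G_sh_def class_A_def subordinate_def)
next
  case (6 n)
  hence n: "n \<ge> 2" by auto
  note f = extremal_function_in_class[OF n]
  from f(2) obtain a where a: "normalized_expansion (extremal_function n) a" by blast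
  have \<omega>: "schwarz_function (\<lambda>z. z ^ (n - 1))" using n by (intro schwarz_function_power) simp
  note c = class_A_coeffs[OF f(1) a \<omega> has_fps_expansion_fps_X_power f(3)]
  \<comment> \<open>For \<open>z ^ (n - 1)\<close> the only nonzero coefficient is a 1 at index
    \<open>n - 1\<close>, so just the linear leading term survives.\<close>
  have "a n = 1 / (of_nat n - 1)"
    using 6 c by (auto simp: fps_X_power_nth field_simps)
  hence "norm (a n) = 1 / (real n - 1)"
    using 6 by auto
  with a show ?case by blast
next
  fix f a assume fa: "f \<in> class_G_sh \<and> normalized_expansion f a"
  then obtain \<omega> where \<omega>: "schwarz_function \<omega>"
      and eq: "\<And>z. z \<in> unit_disc \<Longrightarrow> zf'_over_f f z - 1 = sinh (\<omega> z)"
    by (auto simp: class_G_sh_def subordinate_def)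
  have f: "f holomorphic_on unit_disc" "normalized_expansion f a"
    using fa by (auto simp: class_G_sh_def class_A_def)
  have W: "\<omega> has_fps_expansion fps_expansion \<omega> 0"
    using \<omega> by (intro has_fps_expansion_fps_expansion[of unit_disc]) (auto simp: schwarz_function_def)
  note c = class_A_coeffs[OF f \<omega> W eq]
  show "norm (a 2) \<le> 1"
    using schwarz_norm_coeff_1[OF \<omega> W] c(1) by simp
  have "norm (2 * a 3) \<le> 1" "norm (3 * a 4) \<le> 1" "norm (4 * a 5) \<le> 1"
    using schwarz_norm_functional_2[OF \<omega> W] schwarz_norm_functional_3[OF \<omega> W]
      schwarz_norm_functional_4[OF \<omega> W] by (simp_all only: c)
  thus "norm (a 3) \<le> 1 / 2" "norm (a 4) \<le> 1 / 3" "norm (a 5) \<le> 1 / 4"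
    by (simp_all add: norm_mult)
qed

end
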